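(* For $\varepsilon>0$ define \[ D(\varepsilon):=\sqrt{(1+6\varepsilon)\,\frac{\sinh(2\varepsilon)-2\varepsilon}{(2\varepsilon)^2}},\qquad C(\varepsilon):=\max\Big\{\frac{4\sqrt2+D(\varepsilon)}{1-D(\varepsilon)},\ \sqrt{\frac{1+e^{-\varepsilon}}{1-e^{-\varepsilon}}}\Big\}, \] and let $C_0:=\inf\{C(\varepsilon):\varepsilon>0,\ D(\varepsilon)<1\}$. Then for every integer $n\ge1$ and every family $\eta_1,\dots,\eta_n$ of admissible measures on $\mathbb R$, \[ T\Big(\Big(\tfrac1n\sum_{i=1}^n\eta_i\Big)^{*n}\Big)\le C_0\,T(\eta_1*\cdots*\eta_n). \]
   Context: A finitely supported positive measure $\eta$ on $\mathbb R$ is called admissible if $\int e^x\,\eta(dx)=\int e^{-x}\,\eta(dx)=1$. $T(\eta):=\frac12\int_{\mathbb R}|e^x-e^{-x}|\,\eta(dx)$. $*$ denotes convolution of measures and $\eta^{*n}$ the $n$-fold self-convolution. *)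

theory Defs
  imports Complex_Main
begin

text \<open>A finitely supported positive measure on the reals is represented by its
  mass function w :: real => real (w x = mass of the atom at x).\<close>

definition supp_m :: "(real \<Rightarrow> real) \<Rightarrow> real set" where
  "supp_m w = {x. w x \<noteq> 0}"

definition fs_measure :: "(real \<Rightarrow> real) \<Rightarrow> bool" where
  "fs_measure w \<longleftrightarrow> finite (supp_m w) \<and> (\<forall>x. 0 \<le> w x)"

definition integ :: "(real \<Rightarrow> real) \<Rightarrow> (real \<Rightarrow> real) \<Rightarrow> real" where
  "integ w f = (\<Sum>x\<in>supp_m w. w x * f x)"

definition admissible :: "(real \<Rightarrow> real) \<Rightarrow> bool" where
  "admissible w \<longleftrightarrow> fs_measure w \<and> integ w (\<lambda>x. exp x) = 1 \<and> integ w (\<lambda>x. exp (- x)) = 1"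

definition T :: "(real \<Rightarrow> real) \<Rightarrow> real" where
  "T w = (1/2) * integ w (\<lambda>x. \<bar>exp x - exp (- x)\<bar>)"

definition conv :: "(real \<Rightarrow> real) \<Rightarrow> (real \<Rightarrow> real) \<Rightarrow> (real \<Rightarrow> real)" where
  "conv w v = (\<lambda>z. \<Sum>p\<in>{p \<in> supp_m w \<times> supp_m v. fst p + snd p = z}. w (fst p) * v (snd p))"

definition dirac0 :: "real \<Rightarrow> real" where
  "dirac0 = (\<lambda>x. if x = 0 then 1 else 0)"

primrec conv_pow :: "(real \<Rightarrow> real) \<Rightarrow> nat \<Rightarrow> (real \<Rightarrow> real)" where
  "conv_pow w 0 = dirac0"
| "conv_pow w (Suc n) = conv w (conv_pow w n)"

primrec conv_prod :: "(nat \<Rightarrow> real \<Rightarrow> real) \<Rightarrow> nat \<Rightarrow> (real \<Rightarrow> real)" where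
  "conv_prod eta 0 = dirac0"
| "conv_prod eta (Suc n) = conv (eta n) (conv_prod eta n)"

definition Dfun :: "real \<Rightarrow> real" where
  "Dfun e = sqrt ((1 + 6 * e) * (sinh (2 * e) - 2 * e) / (2 * e)^2)"

definition Cfun :: "real \<Rightarrow> real" where
  "Cfun e = max ((4 * sqrt 2 + Dfun e) / (1 - Dfun e))
                (sqrt ((1 + exp (- e)) / (1 - exp (- e))))"

definition C0 :: real where
  "C0 = Inf (Cfun ` {e. 0 < e \<and> Dfun e < 1})"

end

theory Submission
  imports Defs "HOL-Probability.Sinc_Integral"
begin

text \<open>
  Tilting each \<open>\<eta>\<^sub>i\<close> by \<open>cosh\<close> gives a probability measure under which \<open>t = tanh x\<close> is centered, and
  then \<open>T(\<eta>\<^sub>1 * \<dots> * \<eta>\<^sub>n)\<close> is the mean absolute value of the odd part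
  \<open>(\<Prod>(1 + t\<^sub>i) - \<Prod>(1 - t\<^sub>i)) / 2\<close>. Let \<open>\<delta>\<close> be the sum of the mass defects
  \<open>1 - \<eta>\<^sub>i(\<real>)\<close>. If \<open>\<delta> \<ge> \<epsilon>\<close>, the bounds \<open>1 - m \<le> T \<le> sqrt (1 - m\<^sup>2)\<close> in terms of the total mass
  \<open>m\<close>, together with AM-GM for the masses, suffice. If \<open>\<delta> \<le> \<epsilon>\<close>, the total variance \<open>V\<close> of the
  \<open>t\<^sub>i\<close> is at most \<open>2\<epsilon>\<close>; the odd part differs from its linear term \<open>\<Sum>t\<^sub>i\<close> by at most
  \<open>sqrt (sinh V - V)\<close> in \<open>L\<^sup>2\<close>, which is at most \<open>D(\<epsilon>)\<close> times the \<open>L\<^sup>1\<close> norm of the linear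
  term by a fourth moment bound. Both families have the same \<open>V\<close>, so it remains to compare the
  linear terms: after symmetrization, which costs a factor 2, the characteristic functions are
  nonnegative, and AM-GM with \<open>\<bar>s\<bar> = c \<integral> (1 - cos (u s)) / u\<^sup>2 du\<close> shows that averaging
  decreases the mean absolute value of the sum. The argument gives \<open>2\<close> in place of
  \<open>4 sqrt 2\<close>.
\<close>

section \<open>Finitely supported product expectations\<close>

text \<open>The head of the list is the last coordinate, with weight \<open>p (n - 1)\<close>.\<close>
primrec EE :: "'a set \<Rightarrow> (nat \<Rightarrow> 'a \<Rightarrow> real) \<Rightarrow> nat \<Rightarrow> ('a list \<Rightarrow> real) \<Rightarrow> real" where
  "EE U p 0 g = g []"
| "EE U p (Suc n) g = (\<Sum>x\<in>U. p n x * EE U p n (\<lambda>xs. g (x # xs)))"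

lemma EE_add: "EE U p n (\<lambda>xs. f xs + g xs) = EE U p n f + EE U p n g"
  by (induction n arbitrary: f g) (simp_all add: sum.distrib distrib_left)

lemma EE_cmult: "EE U p n (\<lambda>xs. c * f xs) = c * EE U p n f"
  by (induction n arbitrary: f) (simp_all add: sum_distrib_left mult_ac)

lemma EE_diff: "EE U p n (\<lambda>xs. f xs - g xs) = EE U p n f - EE U p n g"
  using EE_add[of U p n f "\<lambda>xs. - 1 * g xs"] EE_cmult[of U p n "-1" g] by simp

lemma EE_mono:
  assumes "\<And>i x. i < n \<Longrightarrow> x \<in> U \<Longrightarrow> 0 \<le> p i x" and "\<And>xs. f xs \<le> g xs"
  shows "EE U p n f \<le> EE U p n g"
  using assms by (induction n arbitrary: f g) (auto intro!: sum_mono mult_left_mono)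

lemma EE_nonneg:
  assumes "\<And>i x. i < n \<Longrightarrow> x \<in> U \<Longrightarrow> 0 \<le> p i x" and "\<And>xs. 0 \<le> f xs"
  shows "0 \<le> EE U p n f"
  using assms by (induction n arbitrary: f) (auto intro!: sum_nonneg mult_nonneg_nonneg)

lemma EE_const:
  assumes "\<And>i. i < n \<Longrightarrow> (\<Sum>x\<in>U. p i x) = 1"
  shows "EE U p n (\<lambda>_. c) = c"
  using assms by (induction n) (simp_all flip: sum_distrib_right)

text \<open>Change of measure: with \<open>f = cosh\<close> this turns an expectation under the
  tilted weights into one under \<open>eta\<close>.\<close>

lemma EE_weight:
  "EE U (\<lambda>i x. p i x * f x) n g = EE U p n (\<lambda>xs. prod_list (map f xs) * g xs)"
  by (induction n arbitrary: g) (simp_all add: mult.assoc EE_cmult)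

lemma EE_prod:
  "EE U p n (\<lambda>xs. prod_list (map f xs)) = (\<Prod>i<n. \<Sum>x\<in>U. p i x * f x)"
  by (induction n) (simp_all add: EE_cmult mult.assoc sum_distrib_left sum_distrib_right mult_ac)

lemma EE_Cauchy_Schwarz:
  assumes p: "\<And>i x. i < n \<Longrightarrow> x \<in> U \<Longrightarrow> 0 \<le> p i x"
  shows "(EE U p n (\<lambda>xs. f xs * g xs))\<^sup>2 \<le> EE U p n (\<lambda>xs. (f xs)\<^sup>2) * EE U p n (\<lambda>xs. (g xs)\<^sup>2)"
proof -
  define A where "A = EE U p n (\<lambda>xs. (f xs)\<^sup>2)"
  define B where "B = EE U p n (\<lambda>xs. f xs * g xs)"
  define C where "C = EE U p n (\<lambda>xs. (g xs)\<^sup>2)"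
  have q: "0 \<le> A - 2 * c * B + c\<^sup>2 * C" for c
  proof -
    have "0 \<le> EE U p n (\<lambda>xs. (f xs - c * g xs)\<^sup>2)"
      by (rule EE_nonneg[OF p]) auto
    also have "(\<lambda>xs. (f xs - c * g xs)\<^sup>2)
        = (\<lambda>xs. (f xs)\<^sup>2 - 2 * c * (f xs * g xs) + c\<^sup>2 * (g xs)\<^sup>2)"
      by (rule ext) (simp add: power2_eq_square algebra_simps)
    finally show ?thesis
      by (simp add: EE_add EE_diff EE_cmult A_def B_def C_def)
  qed
  have C0: "0 \<le> C" unfolding C_def by (rule EE_nonneg[OF p]) auto
  have "B\<^sup>2 \<le> A * C"
  proof (cases "C = 0")
    case True
    have "B = 0"
    proof (rule ccontr)
      assume "B \<noteq> 0"
      \<comment> \<open>With \<open>C = 0\<close> the quadratic in \<open>c\<close> is affine, and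
        this choice of \<open>c\<close> gives it the value -1.\<close>
      then show False using q[of "(A + 1) / (2 * B)"] True by simp
    qed
    then show ?thesis using True by simp
  next
    case False
    then have "C > 0" using C0 by simp
    have "0 \<le> A - B\<^sup>2 / C"
      using q[of "B / C"] False by (simp add: power2_eq_square)
    then show ?thesis using \<open>C > 0\<close> by (simp add: field_simps)
  qed
  then show ?thesis by (simp add: A_def B_def C_def)
qed

lemma prod_list_map_mult:
  "prod_list (map f xs) * prod_list (map g xs) = prod_list (map (\<lambda>x. f x * g x :: real) xs)"
  by (induction xs) (simp_all add: mult_ac)

lemma prod_list_map_exp:
  "prod_list (map (\<lambda>x. exp (f x :: real)) xs) = exp (sum_list (map f xs))"
  by (induction xs) (simp_all add: exp_add)

section \<open>Measures as product expectations\<close>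

lemma integ_superset:
  assumes "finite U" "supp_m w \<subseteq> U"
  shows "integ w f = (\<Sum>x\<in>U. w x * f x)"
  unfolding integ_def using assms by (intro sum.mono_neutral_left) (auto simp: supp_m_def)

lemma supp_conv: "supp_m (conv w v) \<subseteq> (\<lambda>p. fst p + snd p) ` (supp_m w \<times> supp_m v)"
proof
  fix z assume "z \<in> supp_m (conv w v)"
  then have "conv w v z \<noteq> 0" by (simp add: supp_m_def)
  then have "{p \<in> supp_m w \<times> supp_m v. fst p + snd p = z} \<noteq> {}"
    unfolding conv_def by (metis sum.empty)
  then show "z \<in> (\<lambda>p. fst p + snd p) ` (supp_m w \<times> supp_m v)" by blast
qed

lemma integ_conv:
  assumes "finite (supp_m w)" "finite (supp_m v)"
  shows "integ (conv w v) f = (\<Sum>x\<in>supp_m w. w x * integ v (\<lambda>y. f (x + y)))"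
proof -
  let ?P = "supp_m w \<times> supp_m v"
  let ?I = "(\<lambda>p. fst p + snd p) ` ?P"
  have P: "finite ?P" using assms by simp
  have "integ (conv w v) f = (\<Sum>z\<in>?I. conv w v z * f z)"
    by (rule integ_superset[OF finite_imageI[OF P] supp_conv])
  also have "\<dots> = (\<Sum>z\<in>?I. \<Sum>p\<in>{p \<in> ?P. fst p + snd p = z}. w (fst p) * v (snd p) * f (fst p + snd p))"
    unfolding conv_def sum_distrib_right by (intro sum.cong refl) auto
  also have "\<dots> = (\<Sum>p\<in>?P. w (fst p) * v (snd p) * f (fst p + snd p))"
    by (rule sum.group[OF P finite_imageI[OF P]]) simp
  also have "\<dots> = (\<Sum>x\<in>supp_m w. \<Sum>y\<in>supp_m v. w x * v y * f (x + y))"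
    by (simp add: sum.cartesian_product case_prod_beta)
  finally show ?thesis
    by (simp add: integ_def sum_distrib_left mult.assoc)
qed

lemma finite_supp_conv_prod:
  assumes "\<And>i. i < n \<Longrightarrow> finite (supp_m (eta i))"
  shows "finite (supp_m (conv_prod eta n))"
  using assms
proof (induction n)
  case 0
  have "supp_m dirac0 \<subseteq> {0}" by (auto simp: supp_m_def dirac0_def)
  then show ?case using finite_subset by auto
next
  case (Suc n)
  then have "finite (supp_m (eta n) \<times> supp_m (conv_prod eta n))" by simp
  then show ?case using finite_subset[OF supp_conv] by simp
qed

text \<open>Convolution gives the law of a sum of independent variables. A common finite
  \<open>U\<close> replaces the individual supports, so that every coordinate is summed over the
  same set.\<close>

lemma integ_conv_prod:
  assumes "finite U" "\<And>i. i < n \<Longrightarrow> supp_m (eta i) \<subseteq> U"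
  shows "integ (conv_prod eta n) f = EE U eta n (\<lambda>xs. f (sum_list xs))"
  using assms(2)
proof (induction n arbitrary: f)
  case 0
  have "supp_m dirac0 = {0}" by (auto simp: supp_m_def dirac0_def)
  then show ?case by (simp add: integ_def dirac0_def)
next
  case (Suc n)
  have fin: "finite (supp_m (eta i))" if "i < Suc n" for i
    using Suc.prems[OF that] assms(1) finite_subset by blast
  have "integ (conv_prod eta (Suc n)) f
      = integ (eta n) (\<lambda>x. integ (conv_prod eta n) (\<lambda>y. f (x + y)))"
    using fin finite_supp_conv_prod[of n eta] by (simp add: integ_conv) (simp add: integ_def)
  also have "\<dots> = (\<Sum>x\<in>U. eta n x * integ (conv_prod eta n) (\<lambda>y. f (x + y)))"
    by (rule integ_superset[OF assms(1) Suc.prems]) simp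
  finally show ?case using Suc by simp
qed

lemma conv_pow_eq_conv_prod: "conv_pow w n = conv_prod (\<lambda>_. w) n"
  by (induction n) simp_all

section \<open>Inequalities for products and the hyperbolic sine\<close>

lemma prod_le_arith_mean_power:
  fixes a :: "nat \<Rightarrow> real"
  assumes n: "n \<ge> 1" and a: "\<And>i. i < n \<Longrightarrow> 0 \<le> a i"
  shows "(\<Prod>i<n. a i) \<le> ((\<Sum>i<n. a i) / n) ^ n"
proof -
  let ?P = "\<Prod>i<n. a i"
  have P: "0 \<le> ?P" using a by (intro prod_nonneg) auto
  have le: "?P powr (1 / n) \<le> (\<Sum>i<n. a i) / n"
    using arith_geom_mean[of "{..<n}" a] n a by (simp add: sum_divide_distrib lessThan_empty_iff)
  \<comment> \<open>A vanishing product is treated apart: there \<open>0 powr (1 / n)\<close> is 0,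
    and \<open>n \<ge> 1\<close> makes its power 0 as well.\<close>
  have "?P = (?P powr (1 / n)) ^ n"
  proof (cases "?P = 0")
    case False
    then show ?thesis using n P by (simp add: powr_powr flip: powr_realpow)
  qed (use n in \<open>simp del: prod_zero_iff\<close>)
  also have "\<dots> \<le> ((\<Sum>i<n. a i) / n) ^ n"
    by (rule power_mono[OF le]) simp
  finally show ?thesis .
qed

lemma prod_le_exp_sum:
  fixes h :: "nat \<Rightarrow> real"
  assumes "\<And>i. i < n \<Longrightarrow> h i \<le> 1"
  shows "(\<Prod>i<n. 1 - h i) \<le> exp (- (\<Sum>i<n. h i))"
proof -
  have "(\<Prod>i<n. 1 - h i) \<le> (\<Prod>i<n. exp (- h i))"
    using assms exp_ge_add_one_self[of "- h _"] by (intro prod_mono) (auto simp: algebra_simps)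
  then show ?thesis by (simp add: exp_sum sum_negf[symmetric])
qed

text \<open>Half difference and half sum satisfy the recursion of the addition theorems, with
  \<open>v k\<close> and 1 in place of the larger \<open>sinh (v k)\<close> and
  \<open>cosh (v k)\<close>. The two bounds are therefore proved in one induction.\<close>

lemma prod_diff_le_sinh:
  fixes v :: "nat \<Rightarrow> real"
  assumes "\<And>i. i < n \<Longrightarrow> 0 \<le> v i"
  shows "((\<Prod>i<n. 1 + v i) - (\<Prod>i<n. 1 - v i)) / 2 \<le> sinh (\<Sum>i<n. v i)"
    and "((\<Prod>i<n. 1 + v i) + (\<Prod>i<n. 1 - v i)) / 2 \<le> cosh (\<Sum>i<n. v i)"
proof -
  define s where "s k = ((\<Prod>i<k. 1 + v i) - (\<Prod>i<k. 1 - v i)) / 2" for k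
  define c where "c k = ((\<Prod>i<k. 1 + v i) + (\<Prod>i<k. 1 - v i)) / 2" for k
  have "s n \<le> sinh (\<Sum>i<n. v i) \<and> c n \<le> cosh (\<Sum>i<n. v i) \<and> 0 \<le> s n \<and> 0 \<le> c n"
    using assms
  proof (induction n)
    case 0
    then show ?case by (simp add: s_def c_def)
  next
    case (Suc k)
    let ?V = "\<Sum>i<k. v i"
    have v: "0 \<le> v k" and V: "0 \<le> ?V" using Suc.prems by (auto intro: sum_nonneg)
    have IH: "s k \<le> sinh ?V" "c k \<le> cosh ?V" "0 \<le> s k" "0 \<le> c k"
      using Suc by auto
    have s: "s (Suc k) = s k + v k * c k" and c: "c (Suc k) = c k + v k * s k"
      by (simp_all add: s_def c_def field_simps)
    have sh: "v k \<le> sinh (v k)"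
      using v real_le_x_sinh[of "v k"] by (simp add: sinh_field_def exp_minus)
    have ch: "1 \<le> cosh (v k)" by (rule cosh_real_ge_1)
    have "s k * 1 \<le> sinh ?V * cosh (v k)" "v k * c k \<le> sinh (v k) * cosh ?V"
         "c k * 1 \<le> cosh ?V * cosh (v k)" "v k * s k \<le> sinh (v k) * sinh ?V"
      by (rule mult_mono; use IH v V sh ch order_trans[OF zero_le_one cosh_real_ge_1] in simp)+
    then show ?case
      using IH v by (simp add: s c sinh_add cosh_add mult.commute add.commute)
  qed
  then show "((\<Prod>i<n. 1 + v i) - (\<Prod>i<n. 1 - v i)) / 2 \<le> sinh (\<Sum>i<n. v i)"
    and "((\<Prod>i<n. 1 + v i) + (\<Prod>i<n. 1 - v i)) / 2 \<le> cosh (\<Sum>i<n. v i)"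
    by (simp_all add: s_def c_def)
qed

text \<open>The Taylor coefficients of \<open>sinh x - x\<close> start at degree 3, so \<open>(sinh x - x) / x\<^sup>2\<close> is
  increasing termwise.\<close>
lemma sinh_minus_self_quadratic_mono:
  fixes x y :: real
  assumes "0 \<le> x" "x \<le> y" "0 < y"
  shows "sinh x - x \<le> x\<^sup>2 * ((sinh y - y) / y\<^sup>2)"
proof -
  define l where "l = x / y"
  have l: "0 \<le> l" "l \<le> 1" "x = l * y" using assms by (auto simp: l_def)
  define a :: "real \<Rightarrow> nat \<Rightarrow> real" where
    "a z n = (if even n then 0 else z ^ n /\<^sub>R fact n) - (if n = 1 then z else 0)" for z n
  have a: "a z sums (sinh z - z)" for z
    unfolding a_def by (intro sums_diff sinh_converges sums_single)
  have "a x n \<le> l\<^sup>2 * a y n" for n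
  proof (cases "even n \<or> n = 1")
    case True
    then show ?thesis by (auto simp: a_def)
  next
    case False
    then have "n \<ge> 2" by (cases n) auto
    then have "l ^ n \<le> l\<^sup>2" using l by (intro power_decreasing) auto
    then have "l ^ n * (y ^ n / fact n) \<le> l\<^sup>2 * (y ^ n / fact n)"
      using assms by (intro mult_right_mono) auto
    then show ?thesis using False by (simp add: a_def l(3) power_mult_distrib divide_inverse mult_ac)
  qed
  then have "sinh x - x \<le> l\<^sup>2 * (sinh y - y)"
    by (rule sums_le[OF _ a sums_mult[OF a]])
  then show ?thesis by (simp add: l_def power_divide)
qed

text \<open>Makes the set whose infimum is \<open>C0\<close> nonempty.\<close>

lemma ex_Dfun_less_1: "\<exists>e>0. Dfun e < 1"
proof -
  \<comment> \<open>This is \<open>2 * e\<close> at \<open>e = 1/10\<close>; the bound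
    \<open>1 / 50\<close> below makes the radicand at most 4/5.\<close>
  let ?y = "1 / 5 :: real"
  have "exp ?y \<le> 1 + ?y + ?y\<^sup>2" by (rule exp_bound) auto
  moreover have "1 - ?y \<le> exp (- ?y)" using exp_ge_add_one_self[of "- ?y"] by simp
  ultimately have "sinh ?y - ?y \<le> 1 / 50" by (simp add: sinh_def power2_eq_square)
  then have "(1 + 6 * (1/10)) * (sinh (2 * (1/10)) - 2 * (1/10)) / (2 * (1/10))^2 < (1::real)"
    by (simp add: power2_eq_square)
  then have "Dfun (1/10) < 1" unfolding Dfun_def using real_sqrt_less_mono by fastforce
  then show ?thesis by (intro exI[of _ "1/10"]) auto
qed

section \<open>Sums of independent centered variables\<close>

text \<open>Abstracts from the tilted measures with \<open>\<tau> = tanh\<close>, so that the same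
  moment bounds serve both the given family and its average.\<close>

locale centered_family =
  fixes U :: "'a set" and p :: "nat \<Rightarrow> 'a \<Rightarrow> real" and \<tau> :: "'a \<Rightarrow> real" and n :: nat
  assumes nonneg: "\<And>i x. i < n \<Longrightarrow> x \<in> U \<Longrightarrow> 0 \<le> p i x"
    and total: "\<And>i. i < n \<Longrightarrow> (\<Sum>x\<in>U. p i x) = 1"
    and mean: "\<And>i. i < n \<Longrightarrow> (\<Sum>x\<in>U. p i x * \<tau> x) = 0"
    and bound: "\<And>x. \<bar>\<tau> x\<bar> \<le> 1"
begin

definition v :: "nat \<Rightarrow> real" where
  "v i = (\<Sum>x\<in>U. p i x * (\<tau> x)\<^sup>2)"

definition V :: real where
  "V = (\<Sum>i<n. v i)"

abbreviation lin :: "'a list \<Rightarrow> real" where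
  "lin xs \<equiv> sum_list (map \<tau> xs)"

text \<open>For the tilted measures, \<open>mul 1\<close> and \<open>mul (-1)\<close> are the
  densities of the products of \<open>exp x * eta i x\<close> and of
  \<open>exp (- x) * eta i x\<close>.\<close>

abbreviation mul :: "real \<Rightarrow> 'a list \<Rightarrow> real" where
  "mul a xs \<equiv> prod_list (map (\<lambda>x. 1 + a * \<tau> x) xs)"

definition odd_part :: "'a list \<Rightarrow> real" where
  "odd_part xs = (mul 1 xs - mul (-1) xs) / 2"

lemma v_nonneg: "i < n \<Longrightarrow> 0 \<le> v i"
  unfolding v_def using nonneg by (intro sum_nonneg mult_nonneg_nonneg) auto

lemma V_nonneg: "0 \<le> V"
  unfolding V_def using v_nonneg by (intro sum_nonneg) auto

lemma moments_step:
  assumes "i < n"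
  shows "(\<Sum>x\<in>U. p i x * (c + d * \<tau> x)) = c"
    and "(\<Sum>x\<in>U. p i x * (c + d * \<tau> x + e * (\<tau> x)\<^sup>2)) = c + e * v i"
proof -
  have "(\<Sum>x\<in>U. p i x * (c + d * \<tau> x + e * (\<tau> x)\<^sup>2)) =
      c * (\<Sum>x\<in>U. p i x) + d * (\<Sum>x\<in>U. p i x * \<tau> x) + e * v i" for e
    by (simp add: v_def sum_distrib_left distrib_left sum.distrib mult_ac)
  from this[of e] this[of 0] show
    "(\<Sum>x\<in>U. p i x * (c + d * \<tau> x)) = c"
    "(\<Sum>x\<in>U. p i x * (c + d * \<tau> x + e * (\<tau> x)\<^sup>2)) = c + e * v i"
    using total[OF assms] mean[OF assms] by simp_all
qed

lemma EE_mul: "k \<le> n \<Longrightarrow> EE U p k (mul a) = 1"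
  by (simp add: EE_prod moments_step)

lemma EE_mul_mul: "EE U p n (\<lambda>xs. mul a xs * mul b xs) = (\<Prod>i<n. 1 + a * b * v i)"
proof -
  have eq: "(1 + a * \<tau> x) * (1 + b * \<tau> x) = 1 + (a + b) * \<tau> x + a * b * (\<tau> x)\<^sup>2" for x
    by (simp add: algebra_simps power2_eq_square)
  show ?thesis
    unfolding prod_list_map_mult EE_prod eq by (intro prod.cong refl moments_step(2)) auto
qed

text \<open>For \<open>a = 1\<close> and \<open>a = -1\<close> this shows that
  \<open>odd_part\<close> and \<open>lin\<close> have covariance \<open>V\<close>, the variance of
  \<open>lin\<close>; hence \<open>odd_part - lin\<close> is orthogonal to
  \<open>lin\<close>.\<close>

lemma EE_mul_lin: "k \<le> n \<Longrightarrow> EE U p k (\<lambda>xs. mul a xs * lin xs) = a * (\<Sum>i<k. v i)"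
proof (induction k)
  case (Suc k)
  let ?W = "\<Sum>i<k. v i"
  have "EE U p (Suc k) (\<lambda>xs. mul a xs * lin xs)
      = (\<Sum>x\<in>U. p k x * ((1 + a * \<tau> x) * (\<tau> x * EE U p k (mul a) + EE U p k (\<lambda>xs. mul a xs * lin xs))))"
    by (simp add: EE_cmult EE_add distrib_left mult.assoc mult.left_commute[of _ "\<tau> _"] mult.commute[of _ "\<tau> _"])
  also have "\<dots> = (\<Sum>x\<in>U. p k x * (a * ?W + (1 + a * a * ?W) * \<tau> x + a * (\<tau> x)\<^sup>2))"
    using Suc by (simp add: EE_mul algebra_simps power2_eq_square)
  also have "\<dots> = a * ?W + a * v k" using Suc.prems by (simp add: moments_step)
  finally show ?case by (simp add: distrib_left)
qed simp

lemma EE_lin: "k \<le> n \<Longrightarrow> EE U p k lin = 0"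
  by (induction k) (simp_all add: EE_add EE_const total mean)

lemma EE_lin_square: "k \<le> n \<Longrightarrow> EE U p k (\<lambda>xs. (lin xs)\<^sup>2) = (\<Sum>i<k. v i)"
proof (induction k)
  case (Suc k)
  then have "EE U p (Suc k) (\<lambda>xs. (lin xs)\<^sup>2)
      = (\<Sum>x\<in>U. p k x * ((\<Sum>i<k. v i) + 0 * \<tau> x + 1 * (\<tau> x)\<^sup>2))"
    by (simp add: power2_sum EE_add EE_cmult EE_const total EE_lin mult.assoc add.commute)
  then show ?case
    using Suc.prems by (simp only: moments_step) simp
qed simp

text \<open>By centering, the terms linear in the new variable or in the old sum vanish, and
  \<open>bound\<close> estimates the fourth moment of a single variable by its second.\<close>

lemma EE_lin_fourth:
  "k \<le> n \<Longrightarrow> EE U p k (\<lambda>xs. (lin xs)^4) \<le> (\<Sum>i<k. v i) + 3 * (\<Sum>i<k. v i)\<^sup>2"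
proof (induction k)
  case (Suc k)
  let ?W = "\<Sum>i<k. v i"
  let ?F = "EE U p k (\<lambda>xs. (lin xs)^4)"
  let ?G = "EE U p k (\<lambda>xs. (lin xs)^3)"
  have one: "EE U p k (\<lambda>_. c) = c" for c using Suc.prems total by (intro EE_const) auto
  have k: "k \<le> n" using Suc.prems by simp
  have ex: "(t + s)^4 = t^4 + 4 * t^3 * s + 6 * t^2 * s^2 + 4 * t * s^3 + s^4" for t s :: real
    by (simp add: power_numeral_reduce algebra_simps)
  have t4: "(\<tau> x)^4 \<le> (\<tau> x)\<^sup>2" for x
  proof -
    have "(\<tau> x)\<^sup>2 \<le> 1" using bound[of x] by (simp add: abs_square_le_1)
    then have "(\<tau> x)\<^sup>2 * (\<tau> x)\<^sup>2 \<le> (\<tau> x)\<^sup>2 * 1" by (intro mult_left_mono) auto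
    then show ?thesis by (simp add: power_numeral_reduce mult.assoc)
  qed
  have "EE U p (Suc k) (\<lambda>xs. (lin xs)^4)
      = (\<Sum>x\<in>U. p k x * ((\<tau> x)^4 + 6 * (\<tau> x)\<^sup>2 * ?W + 4 * \<tau> x * ?G + ?F))"
    using k by (simp add: ex EE_add EE_cmult one EE_lin EE_lin_square)
  also have "\<dots> \<le> (\<Sum>x\<in>U. p k x * (?F + 4 * ?G * \<tau> x + (1 + 6 * ?W) * (\<tau> x)\<^sup>2))"
    using Suc.prems nonneg t4 by (intro sum_mono mult_left_mono) (auto simp: algebra_simps)
  also have "\<dots> = ?F + (1 + 6 * ?W) * v k" using Suc.prems by (simp add: moments_step)
  \<comment> \<open>The added slack \<open>3 * (v k)\<^sup>2\<close> completes the square of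
    \<open>?W + v k\<close>.\<close>
  also have "\<dots> \<le> ?W + 3 * ?W\<^sup>2 + (1 + 6 * ?W) * v k + 3 * (v k)\<^sup>2"
    using Suc by (simp add: add_increasing2)
  finally show ?case by (simp add: power2_eq_square algebra_simps)
qed simp

text \<open>In the expanded square, \<open>odd_part\<close> contributes half the difference of the
  two products, the cross term \<open>-2 * V\<close> and the square of \<open>lin\<close> the
  summand \<open>V\<close>.\<close>

lemma EE_odd_minus_lin_square: "EE U p n (\<lambda>xs. (odd_part xs - lin xs)\<^sup>2) \<le> sinh V - V"
proof -
  have "(odd_part xs - lin xs)\<^sup>2 = (1/4) * (mul 1 xs * mul 1 xs) - (1/2) * (mul 1 xs * mul (-1) xs)
      + (1/4) * (mul (-1) xs * mul (-1) xs) - mul 1 xs * lin xs + mul (-1) xs * lin xs + (lin xs)\<^sup>2" for xs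
    by (simp only: odd_part_def power2_eq_square) (simp add: field_simps)
  then have "EE U p n (\<lambda>xs. (odd_part xs - lin xs)\<^sup>2)
     = (1/4) * (\<Prod>i<n. 1 + v i) - (1/2) * (\<Prod>i<n. 1 - v i) + (1/4) * (\<Prod>i<n. 1 + v i) - V"
    by (simp only: EE_add EE_diff EE_cmult EE_mul_mul EE_mul_lin EE_lin EE_lin_square order_refl V_def) simp
  also have "\<dots> = ((\<Prod>i<n. 1 + v i) - (\<Prod>i<n. 1 - v i)) / 2 - V"
    by (simp add: field_simps)
  finally show ?thesis
    using prod_diff_le_sinh(1)[of n v] v_nonneg by (simp add: V_def)
qed

definition L :: real where
  "L = EE U p n (\<lambda>xs. \<bar>lin xs\<bar>)"

lemma L_nonneg: "0 \<le> L"
  unfolding L_def by (rule EE_nonneg[OF nonneg]) auto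

text \<open>Hoelder's inequality between the first, second and fourth moments.\<close>
lemma V_square_le: "V\<^sup>2 \<le> L\<^sup>2 * (1 + 3 * V)"
proof (cases "V = 0")
  case False
  then have V: "V > 0" using V_nonneg by simp
  let ?M = "EE U p n (\<lambda>xs. \<bar>lin xs\<bar>^3)"
  let ?F = "EE U p n (\<lambda>xs. (lin xs)^4)"
  have E2: "EE U p n (\<lambda>xs. (lin xs)\<^sup>2) = V" by (simp add: EE_lin EE_lin_square V_def)
  \<comment> \<open>Cauchy-Schwarz for the splitting of \<open>s\<^sup>2\<close> into the powers 1/2
    and 3/2 of \<open>\<bar>s\<bar>\<close>. The second application splits
    \<open>\<bar>s\<bar>^3\<close> as \<open>\<bar>s\<bar> * s\<^sup>2\<close>, and the third moment
    \<open>?M\<close> is then eliminated.\<close>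
  have "(EE U p n (\<lambda>xs. sqrt \<bar>lin xs\<bar> * (sqrt \<bar>lin xs\<bar>)^3))\<^sup>2
      \<le> EE U p n (\<lambda>xs. (sqrt \<bar>lin xs\<bar>)\<^sup>2) * EE U p n (\<lambda>xs. ((sqrt \<bar>lin xs\<bar>)^3)\<^sup>2)"
    by (rule EE_Cauchy_Schwarz[OF nonneg])
  moreover have "sqrt \<bar>s\<bar> * (sqrt \<bar>s\<bar>)^3 = s\<^sup>2" "((sqrt \<bar>s\<bar>)^3)\<^sup>2 = \<bar>s\<bar>^3" for s
  proof -
    have "sqrt \<bar>s\<bar> * (sqrt \<bar>s\<bar>)^3 = ((sqrt \<bar>s\<bar>)\<^sup>2)\<^sup>2" by algebra
    then show "sqrt \<bar>s\<bar> * (sqrt \<bar>s\<bar>)^3 = s\<^sup>2" by simp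
    have "((sqrt \<bar>s\<bar>)^3)\<^sup>2 = ((sqrt \<bar>s\<bar>)\<^sup>2)^3" by algebra
    then show "((sqrt \<bar>s\<bar>)^3)\<^sup>2 = \<bar>s\<bar>^3" by simp
  qed
  ultimately have 1: "V\<^sup>2 \<le> L * ?M" by (simp add: E2 L_def)
  have "(EE U p n (\<lambda>xs. \<bar>lin xs\<bar> * (lin xs)\<^sup>2))\<^sup>2
      \<le> EE U p n (\<lambda>xs. \<bar>lin xs\<bar>\<^sup>2) * EE U p n (\<lambda>xs. ((lin xs)\<^sup>2)\<^sup>2)"
    by (rule EE_Cauchy_Schwarz[OF nonneg])
  moreover have "\<bar>s\<bar> * s\<^sup>2 = \<bar>s\<bar>^3" "(s\<^sup>2)\<^sup>2 = s^4" for s :: real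
    by (simp_all add: power_numeral_reduce)
  ultimately have 2: "?M\<^sup>2 \<le> V * ?F" by (simp add: E2)
  have 3: "?F \<le> V + 3 * V\<^sup>2" using EE_lin_fourth[of n] by (simp add: V_def)
  have "(V\<^sup>2)\<^sup>2 \<le> (L * ?M)\<^sup>2" using 1 by (intro power_mono) auto
  also have "\<dots> = L\<^sup>2 * ?M\<^sup>2" by (simp add: power_mult_distrib)
  also have "\<dots> \<le> L\<^sup>2 * (V * (V + 3 * V\<^sup>2))"
    using 2 3 V by (intro mult_left_mono order_trans[OF 2]) auto
  finally have "V\<^sup>2 * V\<^sup>2 \<le> V\<^sup>2 * (L\<^sup>2 * (1 + 3 * V))" by (simp add: power2_eq_square algebra_simps)
  then show ?thesis using V by (simp only: mult_le_cancel_left_pos zero_less_power)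
qed simp

lemma EE_abs_le_sqrt: "EE U p n (\<lambda>xs. \<bar>f xs\<bar>) \<le> sqrt (EE U p n (\<lambda>xs. (f xs)\<^sup>2))"
  using EE_Cauchy_Schwarz[of n U p, OF nonneg, where f = "\<lambda>xs. \<bar>f xs\<bar>" and g = "\<lambda>_. 1"]
  by (intro real_le_rsqrt) (simp add: EE_const total)

text \<open>Kept in two halves because the intermediate quantity depends on \<open>V\<close> only:
  the average has the same \<open>V\<close>, so its residual can be bounded by the \<open>L\<close>
  of the original family.\<close>

lemma EE_odd_minus_lin:
  assumes "0 < e" "V \<le> 2 * e"
  shows "EE U p n (\<lambda>xs. \<bar>odd_part xs - lin xs\<bar>) \<le> sqrt (sinh V - V)"
    and "sqrt (sinh V - V) \<le> Dfun e * L"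
proof -
  show "EE U p n (\<lambda>xs. \<bar>odd_part xs - lin xs\<bar>) \<le> sqrt (sinh V - V)"
    using order_trans[OF EE_abs_le_sqrt real_sqrt_le_mono[OF EE_odd_minus_lin_square]] .
  let ?q = "(sinh (2 * e) - 2 * e) / (2 * e)\<^sup>2"
  have q: "0 \<le> ?q" using assms real_le_x_sinh[of "2 * e"] by (simp add: sinh_field_def exp_minus)
  have "sinh V - V \<le> V\<^sup>2 * ?q"
    using assms V_nonneg by (intro sinh_minus_self_quadratic_mono) auto
  also have "\<dots> \<le> (L\<^sup>2 * (1 + 6 * e)) * ?q"
    using assms by (intro mult_right_mono q order_trans[OF V_square_le] mult_left_mono) auto
  finally have "sqrt (sinh V - V) \<le> sqrt ((L\<^sup>2 * (1 + 6 * e)) * ?q)"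
    by (rule real_sqrt_le_mono)
  also have "\<dots> = Dfun e * L"
    using L_nonneg by (simp add: Dfun_def real_sqrt_mult real_sqrt_divide mult_ac)
  finally show "sqrt (sinh V - V) \<le> Dfun e * L" .
qed

end

section \<open>Averaging decreases the mean absolute value\<close>

definition cos_kernel :: "real \<Rightarrow> real" where
  "cos_kernel u = (1 - cos u) / u\<^sup>2"

lemma cos_kernel_nonneg: "0 \<le> cos_kernel u"
  by (simp add: cos_kernel_def)

lemma integrable_cos_kernel: "integrable lborel cos_kernel"
proof (rule Bochner_Integration.integrable_bound)
  have "integrable lborel (\<lambda>u::real. inverse (1 + u\<^sup>2))"
    using integrable_inverse_1_plus_square by (simp add: set_integrable_def)
  then show "integrable lborel (\<lambda>u::real. 3 * inverse (1 + u\<^sup>2))" by simp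
  show "cos_kernel \<in> borel_measurable lborel" unfolding cos_kernel_def by measurable
  have "norm (cos_kernel u) \<le> norm (3 * inverse (1 + u\<^sup>2))" for u
  proof (cases "u = 0")
    case False
    have "1 - cos u = 2 * (sin (u/2))\<^sup>2" using cos_double_sin[of "u/2"] by simp
    also have "\<dots> \<le> 2 * (u/2)\<^sup>2"
      using abs_sin_x_le_abs_x[of "u/2"] by (simp only: abs_le_square_iff)
    finally have 1: "1 - cos u \<le> u\<^sup>2 / 2" by (simp add: power2_eq_square)
    have "(1 - cos u) * u\<^sup>2 \<le> 2 * u\<^sup>2"
      using cos_ge_minus_one[of u] by (intro mult_right_mono) auto
    \<comment> \<open>One bound is sharp near 0, the other is good at infinity; their sum
      \<open>5/2 * u\<^sup>2\<close> is then rounded up to \<open>3 * u\<^sup>2\<close>.\<close>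
    from add_mono[OF 1 this] have "(1 - cos u) * (1 + u\<^sup>2) \<le> u\<^sup>2 / 2 + 2 * u\<^sup>2"
      by (simp only: distrib_left mult_1_right)
    then have "(1 - cos u) * (1 + u\<^sup>2) \<le> 3 * u\<^sup>2"
      by (rule order_trans) simp
    moreover have "0 < 1 + u\<^sup>2" by (simp add: add_pos_nonneg)
    ultimately have "cos_kernel u \<le> 3 * inverse (1 + u\<^sup>2)"
      using False by (simp add: cos_kernel_def field_simps)
    then show ?thesis using cos_kernel_nonneg[of u] by simp
  qed (simp add: cos_kernel_def)
  then show "AE u in lborel. norm (cos_kernel u) \<le> norm (3 * inverse (1 + u\<^sup>2))" by simp
qed

text \<open>A nonnegative function with zero integral vanishes almost everywhere, but the kernel is
  positive on \<open>{1..2}\<close>.\<close>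

lemma integral_cos_kernel_pos: "0 < integral\<^sup>L lborel cos_kernel"
proof -
  have "integral\<^sup>L lborel cos_kernel \<noteq> 0"
  proof
    assume "integral\<^sup>L lborel cos_kernel = 0"
    then have "AE u in lborel. cos_kernel u = 0"
      using integral_nonneg_eq_0_iff_AE[OF integrable_cos_kernel] cos_kernel_nonneg by auto
    then have "AE u in lborel. u \<notin> {1..2::real}"
    proof eventually_elim
      case (elim u)
      have "cos u < 1" if "1 \<le> u" "u \<le> 2"
        using that cos_monotone_0_pi[of 0 u] pi_gt3 by simp
      then show ?case using elim by (auto simp: cos_kernel_def)
    qed
    then have "emeasure lborel {1..2::real} = 0"
      by (subst (asm) AE_iff_measurable[OF _ refl]) (auto simp: atLeastAtMost_def atLeast_def atMost_def Collect_conj_eq)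
    then show False by simp
  qed
  moreover have "0 \<le> integral\<^sup>L lborel cos_kernel"
    using cos_kernel_nonneg by simp
  ultimately show ?thesis by simp
qed

text \<open>At \<open>u = 0\<close> both sides are \<open>x / 0 = 0\<close>, so the scaling identity holds everywhere.\<close>
lemma cos_kernel_scale:
  fixes s u :: real
  shows "(1 - cos (u * s)) / u\<^sup>2 = s\<^sup>2 * cos_kernel (0 + s * u)"
  by (cases "s = 0") (simp_all add: cos_kernel_def power_mult_distrib mult.commute)

lemma integrable_cos_kernel_scaled:
  fixes s :: real
  shows "integrable lborel (\<lambda>u. (1 - cos (u * s)) / u\<^sup>2)"
  unfolding cos_kernel_scale
  using lborel_integrable_real_affine[OF integrable_cos_kernel, of s 0] by (cases "s = 0") simp_all

text \<open>Substituting \<open>s * u\<close> for \<open>u\<close> turns the factor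
  \<open>s\<^sup>2\<close> into \<open>\<bar>s\<bar>\<close>.\<close>

lemma abs_eq_integral_cos:
  fixes s :: real
  shows "integral\<^sup>L lborel cos_kernel * \<bar>s\<bar> = (\<integral>u. (1 - cos (u * s)) / u\<^sup>2 \<partial>lborel)"
proof (cases "s = 0")
  case False
  have "integral\<^sup>L lborel cos_kernel * \<bar>s\<bar> = s\<^sup>2 * (\<integral>u. cos_kernel (0 + s * u) \<partial>lborel)"
    using lborel_integral_real_affine[OF False, of cos_kernel 0]
    by (simp add: power2_abs[symmetric, of s] power2_eq_square[of "\<bar>s\<bar>"] mult.commute del: power2_abs)
  then show ?thesis unfolding cos_kernel_scale by simp
qed simp

lemma EE_integral:
  assumes "\<And>xs. integrable M (\<lambda>u. h u xs)"
  shows "integrable M (\<lambda>u. EE U p n (h u))"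
    and "(\<integral>u. EE U p n (h u) \<partial>M) = EE U p n (\<lambda>xs. \<integral>u. h u xs \<partial>M)"
proof -
  have "integrable M (\<lambda>u. EE U p n (h u)) \<and>
      (\<integral>u. EE U p n (h u) \<partial>M) = EE U p n (\<lambda>xs. \<integral>u. h u xs \<partial>M)"
    using assms
    by (induction n arbitrary: h) (simp_all add: Bochner_Integration.integral_sum)
  then show "integrable M (\<lambda>u. EE U p n (h u))"
    and "(\<integral>u. EE U p n (h u) \<partial>M) = EE U p n (\<lambda>xs. \<integral>u. h u xs \<partial>M)" by auto
qed

text \<open>Reduces a comparison of mean absolute values to one of the real parts of characteristic
  functions at each frequency, which is then integrated against
  \<open>1 / u\<^sup>2\<close>.\<close>

lemma EE_abs_le_by_cos:
  assumes le: "\<And>u. EE U p n (\<lambda>xs. 1 - cos (u * f xs)) \<le> EE W q m (\<lambda>xs. 1 - cos (u * g xs))"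
  shows "EE U p n (\<lambda>xs. \<bar>f xs\<bar>) \<le> EE W q m (\<lambda>xs. \<bar>g xs\<bar>)"
proof -
  \<comment> \<open>The fresh type variable \<open>'c\<close> lets these facts apply to both
    expectations.\<close>
  have *: "integrable lborel (\<lambda>u. EE U p n (\<lambda>xs. (1 - cos (u * f xs)) / u\<^sup>2))"
    "(\<integral>u. EE U p n (\<lambda>xs. (1 - cos (u * f xs)) / u\<^sup>2) \<partial>lborel)
      = integral\<^sup>L lborel cos_kernel * EE U p n (\<lambda>xs. \<bar>f xs\<bar>)"
    for U :: "'c set" and p n f
    using EE_integral[of lborel "\<lambda>u xs. (1 - cos (u * f xs)) / u\<^sup>2" U p n,
        OF integrable_cos_kernel_scaled]
    by (simp_all flip: abs_eq_integral_cos add: EE_cmult)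
  have "EE U p n (\<lambda>xs. (1 - cos (u * f xs)) / u\<^sup>2) \<le> EE W q m (\<lambda>xs. (1 - cos (u * g xs)) / u\<^sup>2)" for u
    using mult_left_mono[OF le[of u], of "1 / u\<^sup>2"] by (simp flip: EE_cmult)
  then have "integral\<^sup>L lborel cos_kernel * EE U p n (\<lambda>xs. \<bar>f xs\<bar>)
      \<le> integral\<^sup>L lborel cos_kernel * EE W q m (\<lambda>xs. \<bar>g xs\<bar>)"
    unfolding *(2)[symmetric] by (intro integral_mono *(1))
  then show ?thesis using integral_cos_kernel_pos by (simp add: mult_le_cancel_left_pos)
qed

text \<open>Without sine parts the characteristic functions are real and multiply. The phase
  \<open>c\<close> absorbs the head of the list in the induction.\<close>

lemma EE_cos_sum:
  assumes "\<And>i. i < n \<Longrightarrow> (\<Sum>x\<in>U. p i x * sin (u * \<sigma> x)) = 0"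
  shows "EE U p n (\<lambda>xs. cos (c + u * sum_list (map \<sigma> xs)))
    = cos c * (\<Prod>i<n. \<Sum>x\<in>U. p i x * cos (u * \<sigma> x))"
  using assms
proof (induction n arbitrary: c)
  case (Suc n)
  define P where "P = (\<Prod>i<n. \<Sum>x\<in>U. p i x * cos (u * \<sigma> x))"
  have IH: "EE U p n (\<lambda>xs. cos (c + u * (\<sigma> x + sum_list (map \<sigma> xs)))) = cos (c + u * \<sigma> x) * P" for x
    using Suc.IH[of "c + u * \<sigma> x"] Suc.prems by (simp add: distrib_left add.assoc P_def)
  have "EE U p (Suc n) (\<lambda>xs. cos (c + u * sum_list (map \<sigma> xs)))
      = (\<Sum>x\<in>U. p n x * (cos (c + u * \<sigma> x) * P))"
    by (simp add: IH)
  also have "\<dots> = cos c * P * (\<Sum>x\<in>U. p n x * cos (u * \<sigma> x))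
      - sin c * P * (\<Sum>x\<in>U. p n x * sin (u * \<sigma> x))"
    by (simp add: cos_add sum_distrib_left sum_subtractf[symmetric] algebra_simps)
  finally show ?case using Suc.prems by (simp add: P_def)
qed simp

section \<open>Mixtures and symmetrization\<close>

definition avg :: "nat \<Rightarrow> (nat \<Rightarrow> 'a \<Rightarrow> real) \<Rightarrow> 'a \<Rightarrow> real" where
  "avg n p x = (1 / real n) * (\<Sum>i<n. p i x)"

lemma sum_avg: "(\<Sum>x\<in>U. avg n p x * f x) = (1 / real n) * (\<Sum>i<n. \<Sum>x\<in>U. p i x * f x)"
proof -
  have "(\<Sum>x\<in>U. avg n p x * f x) = (\<Sum>x\<in>U. \<Sum>i<n. (1 / real n) * (p i x * f x))"
    by (simp add: avg_def sum_distrib_left sum_distrib_right mult.assoc)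
  also have "\<dots> = (\<Sum>i<n. \<Sum>x\<in>U. (1 / real n) * (p i x * f x))" by (rule sum.swap)
  finally show ?thesis by (simp add: sum_distrib_left)
qed

lemma avg_nonneg: "(\<And>i. i < n \<Longrightarrow> 0 \<le> p i x) \<Longrightarrow> 0 \<le> avg n p x"
  unfolding avg_def by (intro mult_nonneg_nonneg sum_nonneg) auto

text \<open>The joint law of two independent copies of variable \<open>i\<close>, whose difference
  is the symmetrized variable.\<close>

definition self_pair :: "(nat \<Rightarrow> 'a \<Rightarrow> real) \<Rightarrow> nat \<Rightarrow> 'a \<times> 'a \<Rightarrow> real" where
  "self_pair p i z = p i (fst z) * p i (snd z)"

lemma sum_self_pair:
  "(\<Sum>z\<in>U \<times> U. self_pair p i z * f z) = (\<Sum>x\<in>U. \<Sum>y\<in>U. p i x * (p i y * f (x, y)))"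
  by (simp add: self_pair_def sum.cartesian_product case_prod_beta mult.assoc)

lemma EE_map:
  assumes "\<And>i g. i < n \<Longrightarrow> (\<Sum>z\<in>W. q i z * g (h z)) = (\<Sum>x\<in>U. p i x * g x)"
  shows "EE W q n (\<lambda>zs. f (map h zs)) = EE U p n f"
  using assms
proof (induction n arbitrary: f)
  case (Suc n)
  have "EE W q (Suc n) (\<lambda>zs. f (map h zs)) = (\<Sum>z\<in>W. q n z * EE U p n (\<lambda>xs. f (h z # xs)))"
    using Suc.IH[of "\<lambda>xs. f (h _ # xs)"] Suc.prems by simp
  also have "\<dots> = EE U p (Suc n) f"
    using Suc.prems[of n "\<lambda>x. EE U p n (\<lambda>xs. f (x # xs))"] by simp
  finally show ?case .
qed simp

lemma EE_self_pair_marginals: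
  assumes "\<And>i. i < n \<Longrightarrow> (\<Sum>x\<in>U. p i x) = 1"
  shows "EE (U \<times> U) (self_pair p) n (\<lambda>zs. f (map fst zs)) = EE U p n f"
    and "EE (U \<times> U) (self_pair p) n (\<lambda>zs. f (map snd zs)) = EE U p n f"
  using assms
  by (auto intro!: EE_map simp: sum_self_pair simp flip: sum_distrib_left sum_distrib_right)

text \<open>Allows Jensen's inequality in one coordinate, carried by the shift, while
  \<open>s\<close> holds the remaining ones.\<close>

lemma convex_on_EE_abs_add:
  assumes "\<And>i x. i < n \<Longrightarrow> x \<in> U \<Longrightarrow> 0 \<le> p i x"
  shows "convex_on UNIV (\<lambda>c. EE U p n (\<lambda>xs. \<bar>c + s xs\<bar>))"
proof (rule convex_onI)
  fix t x y :: real assume t: "0 < t" "t < 1"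
  have "EE U p n (\<lambda>xs. \<bar>((1 - t) *\<^sub>R x + t *\<^sub>R y) + s xs\<bar>)
      \<le> EE U p n (\<lambda>xs. (1 - t) * \<bar>x + s xs\<bar> + t * \<bar>y + s xs\<bar>)"
  proof (rule EE_mono[OF assms])
    fix xs
    have "((1 - t) *\<^sub>R x + t *\<^sub>R y) + s xs = (1 - t) * (x + s xs) + t * (y + s xs)"
      by (simp add: algebra_simps)
    then show "\<bar>((1 - t) *\<^sub>R x + t *\<^sub>R y) + s xs\<bar> \<le> (1 - t) * \<bar>x + s xs\<bar> + t * \<bar>y + s xs\<bar>"
      using t abs_triangle_ineq[of "(1 - t) * (x + s xs)" "t * (y + s xs)"] by (simp add: abs_mult)
  qed
  then show "EE U p n (\<lambda>xs. \<bar>((1 - t) *\<^sub>R x + t *\<^sub>R y) + s xs\<bar>)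
      \<le> (1 - t) * EE U p n (\<lambda>xs. \<bar>x + s xs\<bar>) + t * EE U p n (\<lambda>xs. \<bar>y + s xs\<bar>)"
    by (simp add: EE_add EE_cmult)
qed simp

context centered_family
begin

lemma Jensen_centered:
  assumes i: "i < n" and \<phi>: "convex_on UNIV \<phi>"
  shows "\<phi> c \<le> (\<Sum>y\<in>U. p i y * \<phi> (c - \<tau> y))"
proof -
  have U: "finite U" "U \<noteq> {}" using total[OF i] by (auto intro: ccontr)
  have "(\<Sum>y\<in>U. p i y * (c - \<tau> y)) = c"
    using moments_step(1)[OF i, of c "-1"] by simp
  then show ?thesis
    using convex_on_sum[OF U \<phi> total[OF i], of "\<lambda>y. c - \<tau> y"] nonneg[OF i] by simp
qed

abbreviation \<sigma> :: "'a \<times> 'a \<Rightarrow> real" where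
  "\<sigma> z \<equiv> \<tau> (fst z) - \<tau> (snd z)"

text \<open>The average is a mixture, and each component is symmetrized with a copy of itself. This
  yields the average of the symmetrized laws rather than the symmetrization of the average, which is
  what AM-GM can compare with the original family.\<close>

lemma EE_avg_symmetrize:
  "EE U (\<lambda>_. avg n p) k (\<lambda>xs. \<bar>c + lin xs\<bar>)
    \<le> EE (U \<times> U) (\<lambda>_. avg n (self_pair p)) k (\<lambda>zs. \<bar>c + sum_list (map \<sigma> zs)\<bar>)"
proof (induction k arbitrary: c)
  case (Suc k)
  let ?\<phi> = "\<lambda>c. EE (U \<times> U) (\<lambda>_. avg n (self_pair p)) k (\<lambda>zs. \<bar>c + sum_list (map \<sigma> zs)\<bar>)"
  have convex: "convex_on UNIV ?\<phi>"
    by (rule convex_on_EE_abs_add) (auto intro!: avg_nonneg mult_nonneg_nonneg nonneg simp: self_pair_def)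
  have "EE U (\<lambda>_. avg n p) (Suc k) (\<lambda>xs. \<bar>c + lin xs\<bar>)
      \<le> (\<Sum>x\<in>U. avg n p x * ?\<phi> (c + \<tau> x))"
    using Suc.IH[of "c + \<tau> _"]
    by (auto intro!: sum_mono mult_left_mono avg_nonneg nonneg simp: add.assoc)
  also have "\<dots> = (1 / real n) * (\<Sum>i<n. \<Sum>x\<in>U. p i x * ?\<phi> (c + \<tau> x))"
    by (rule sum_avg)
  also have "\<dots> \<le> (1 / real n) * (\<Sum>i<n. \<Sum>x\<in>U. p i x * (\<Sum>y\<in>U. p i y * ?\<phi> ((c + \<tau> x) - \<tau> y)))"
    by (intro sum_mono mult_left_mono Jensen_centered convex nonneg) auto
  also have "\<dots> = (1 / real n) * (\<Sum>i<n. \<Sum>z\<in>U \<times> U. self_pair p i z * ?\<phi> (c + \<sigma> z))"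
    by (simp add: sum_self_pair sum_distrib_left add_diff_eq)
  also have "\<dots> = (\<Sum>z\<in>U \<times> U. avg n (self_pair p) z * ?\<phi> (c + \<sigma> z))"
    by (rule sum_avg[symmetric])
  finally show ?case by (simp add: add.assoc)
qed simp

text \<open>The characteristic function of a symmetrized variable is \<open>\<bar>f\<bar>\<^sup>2 \<ge> 0\<close>, so the
  AM-GM inequality compares the characteristic functions of the two sums.\<close>
lemma EE_avg_self_pair_le:
  assumes n: "n \<ge> 1"
  shows "EE (U \<times> U) (\<lambda>_. avg n (self_pair p)) n (\<lambda>zs. \<bar>sum_list (map \<sigma> zs)\<bar>)
    \<le> EE (U \<times> U) (self_pair p) n (\<lambda>zs. \<bar>sum_list (map \<sigma> zs)\<bar>)"
proof (rule EE_abs_le_by_cos)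
  fix u :: real
  define ch where "ch i = (\<Sum>z\<in>U \<times> U. self_pair p i z * cos (u * \<sigma> z))" for i
  \<comment> \<open>Exchanging the two copies reverses the sign of the sine.\<close>
  have sin0: "(\<Sum>z\<in>U \<times> U. self_pair p i z * sin (u * \<sigma> z)) = 0" for i
  proof -
    have "(\<Sum>z\<in>U \<times> U. self_pair p i z * sin (u * \<sigma> z))
        = (\<Sum>x\<in>U. \<Sum>y\<in>U. (p i x * sin (u * \<tau> x)) * (p i y * cos (u * \<tau> y)))
        - (\<Sum>x\<in>U. \<Sum>y\<in>U. (p i x * cos (u * \<tau> x)) * (p i y * sin (u * \<tau> y)))"
      by (simp add: sum_self_pair sin_diff right_diff_distrib sum_subtractf mult_ac)
    then show ?thesis by (simp add: sum_product[symmetric] mult.commute)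
  qed
  have ch: "0 \<le> ch i" for i
  proof -
    have "ch i = (\<Sum>x\<in>U. \<Sum>y\<in>U. (p i x * cos (u * \<tau> x)) * (p i y * cos (u * \<tau> y)))
        + (\<Sum>x\<in>U. \<Sum>y\<in>U. (p i x * sin (u * \<tau> x)) * (p i y * sin (u * \<tau> y)))"
      by (simp add: ch_def sum_self_pair cos_diff right_diff_distrib distrib_left sum.distrib mult_ac)
    then show ?thesis by (simp add: sum_product[symmetric])
  qed
  have tot: "(\<Sum>z\<in>U \<times> U. self_pair p i z) = 1" if "i < n" for i
    using sum_self_pair[of p i "\<lambda>_. 1" U] total[OF that] by (simp flip: sum_distrib_left)
  have atot: "(\<Sum>z\<in>U \<times> U. avg n (self_pair p) z) = 1"
    using sum_avg[of n "self_pair p" "\<lambda>_. 1" "U \<times> U"] tot n by simp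
  have "EE (U \<times> U) (self_pair p) n (\<lambda>zs. cos (u * sum_list (map \<sigma> zs))) = (\<Prod>i<n. ch i)"
    using EE_cos_sum[where p = "self_pair p" and \<sigma> = \<sigma> and c = 0] sin0 by (simp add: ch_def)
  also have "\<dots> \<le> ((\<Sum>i<n. ch i) / n) ^ n"
    by (rule prod_le_arith_mean_power[OF n ch])
  also have "\<dots> = EE (U \<times> U) (\<lambda>_. avg n (self_pair p)) n (\<lambda>zs. cos (u * sum_list (map \<sigma> zs)))"
    using EE_cos_sum[where p = "\<lambda>_. avg n (self_pair p)" and \<sigma> = \<sigma> and c = 0] sin0
    by (simp add: sum_avg ch_def)
  finally show "EE (U \<times> U) (\<lambda>_. avg n (self_pair p)) n (\<lambda>zs. 1 - cos (u * sum_list (map \<sigma> zs)))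
      \<le> EE (U \<times> U) (self_pair p) n (\<lambda>zs. 1 - cos (u * sum_list (map \<sigma> zs)))"
    using tot atot by (simp add: EE_diff EE_const)
qed

text \<open>The factor 2 comes from undoing the symmetrization by the triangle inequality, each copy
  contributing \<open>L\<close>.\<close>

lemma EE_avg_lin_le:
  assumes n: "n \<ge> 1"
  shows "EE U (\<lambda>_. avg n p) n (\<lambda>xs. \<bar>lin xs\<bar>) \<le> 2 * L"
proof -
  have "EE U (\<lambda>_. avg n p) n (\<lambda>xs. \<bar>lin xs\<bar>)
      \<le> EE (U \<times> U) (self_pair p) n (\<lambda>zs. \<bar>sum_list (map \<sigma> zs)\<bar>)"
    using EE_avg_symmetrize[of n 0] EE_avg_self_pair_le[OF n] by simp
  also have "\<dots> \<le> EE (U \<times> U) (self_pair p) n (\<lambda>zs. \<bar>lin (map fst zs)\<bar> + \<bar>lin (map snd zs)\<bar>)"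
  proof (rule EE_mono)
    fix zs :: "('a \<times> 'a) list"
    have "sum_list (map \<sigma> zs) = lin (map fst zs) - lin (map snd zs)"
      by (induction zs) simp_all
    then show "\<bar>sum_list (map \<sigma> zs)\<bar> \<le> \<bar>lin (map fst zs)\<bar> + \<bar>lin (map snd zs)\<bar>" by simp
  qed (auto simp: self_pair_def nonneg)
  also have "\<dots> = 2 * L"
    using EE_self_pair_marginals[of n p U "\<lambda>xs. \<bar>lin xs\<bar>", OF total] by (simp add: EE_add L_def)
  finally show ?thesis .
qed

lemma centered_family_avg:
  assumes n: "n \<ge> 1"
  shows "centered_family U (\<lambda>_. avg n p) \<tau> n"
proof
  show "(\<Sum>x\<in>U. avg n p x) = 1"
    using sum_avg[of n p "\<lambda>_. 1" U] total n by simp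
qed (use n in \<open>auto simp: sum_avg mean bound intro!: avg_nonneg nonneg\<close>)

text \<open>Second moments are linear in the weights, so \<open>n\<close> copies of the average have
  the same total.\<close>

lemma V_avg:
  assumes n: "n \<ge> 1"
  shows "centered_family.V U (\<lambda>_. avg n p) \<tau> n = V"
  using n unfolding centered_family.V_def[OF centered_family_avg[OF n]]
    centered_family.v_def[OF centered_family_avg[OF n]]
  by (simp add: sum_avg V_def v_def)

text \<open>Exchanging odd part and linear term costs \<open>Dfun e * L\<close> twice: it is added
  for the average, and for the original family it leaves the factor
  \<open>1 - Dfun e\<close>.\<close>

lemma EE_avg_odd_part_le:
  assumes n: "n \<ge> 1" and e: "0 < e" "V \<le> 2 * e" and D: "Dfun e < 1"
  shows "EE U (\<lambda>_. avg n p) n (\<lambda>xs. \<bar>odd_part xs\<bar>)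
    \<le> (4 * sqrt 2 + Dfun e) / (1 - Dfun e) * EE U p n (\<lambda>xs. \<bar>odd_part xs\<bar>)"
proof -
  interpret A: centered_family U "\<lambda>_. avg n p" \<tau> n
    by (rule centered_family_avg[OF n])
  have "EE U (\<lambda>_. avg n p) n (\<lambda>xs. \<bar>odd_part xs\<bar>)
      \<le> EE U (\<lambda>_. avg n p) n (\<lambda>xs. \<bar>lin xs\<bar> + \<bar>odd_part xs - lin xs\<bar>)"
    by (rule EE_mono[OF A.nonneg]) auto
  also have "\<dots> \<le> 2 * L + Dfun e * L"
    using EE_avg_lin_le[OF n] A.EE_odd_minus_lin(1)[OF e(1)] EE_odd_minus_lin(2)[OF e] e(2)
    by (simp add: EE_add V_avg[OF n])
  \<comment> \<open>The constant 2 is weakened here to match the form of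
    \<open>Cfun\<close>.\<close>
  also have "\<dots> \<le> (4 * sqrt 2 + Dfun e) * L"
  proof -
    have "1 \<le> sqrt 2" by simp
    then have "2 \<le> 4 * sqrt 2" by linarith
    then have "2 * L \<le> 4 * sqrt 2 * L" using L_nonneg by (rule mult_right_mono)
    then show ?thesis by (simp add: distrib_right)
  qed
  finally have 1: "EE U (\<lambda>_. avg n p) n (\<lambda>xs. \<bar>odd_part xs\<bar>) \<le> (4 * sqrt 2 + Dfun e) * L" .
  have "L \<le> EE U p n (\<lambda>xs. \<bar>odd_part xs\<bar> + \<bar>odd_part xs - lin xs\<bar>)"
    unfolding L_def by (rule EE_mono[OF nonneg]) auto
  also have "\<dots> \<le> EE U p n (\<lambda>xs. \<bar>odd_part xs\<bar>) + Dfun e * L"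
    using EE_odd_minus_lin[OF e] by (simp add: EE_add)
  finally have 2: "L \<le> EE U p n (\<lambda>xs. \<bar>odd_part xs\<bar>) / (1 - Dfun e)"
    using D by (simp add: pos_le_divide_eq algebra_simps)
  have "0 \<le> sinh (2 * e) - 2 * e" using e(1) real_le_x_sinh[of "2 * e"]
    by (simp add: sinh_field_def exp_minus)
  then have "0 \<le> Dfun e" using e(1) by (simp add: Dfun_def)
  then have "(4 * sqrt 2 + Dfun e) * L \<le> (4 * sqrt 2 + Dfun e) * (EE U p n (\<lambda>xs. \<bar>odd_part xs\<bar>) / (1 - Dfun e))"
    using 2 by (intro mult_left_mono) auto
  then show ?thesis using 1 by simp
qed

end

section \<open>Admissible families\<close>

locale admissible_family =
  fixes U :: "real set" and eta :: "nat \<Rightarrow> real \<Rightarrow> real" and n :: nat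
  assumes finite_U: "finite U" and supp: "\<And>i. i < n \<Longrightarrow> supp_m (eta i) \<subseteq> U"
    and adm: "\<And>i. i < n \<Longrightarrow> admissible (eta i)"
begin

definition mass :: "nat \<Rightarrow> real" where
  "mass i = (\<Sum>x\<in>U. eta i x)"

lemma eta_nonneg: "i < n \<Longrightarrow> 0 \<le> eta i x"
  using adm by (simp add: admissible_def fs_measure_def)

lemma sum_eta_exp:
  assumes "i < n"
  shows "(\<Sum>x\<in>U. eta i x * exp x) = 1" "(\<Sum>x\<in>U. eta i x * exp (- x)) = 1"
  using adm[OF assms] integ_superset[OF finite_U supp[OF assms]] by (auto simp: admissible_def)

lemma sum_eta_cosh_sinh:
  assumes "i < n"
  shows "(\<Sum>x\<in>U. eta i x * cosh x) = 1" "(\<Sum>x\<in>U. eta i x * sinh x) = 0"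
proof -
  have "(\<Sum>x\<in>U. eta i x * cosh x) = ((\<Sum>x\<in>U. eta i x * exp x) + (\<Sum>x\<in>U. eta i x * exp (- x))) / 2"
    by (simp add: cosh_field_def sum_divide_distrib sum.distrib[symmetric] distrib_left)
  then show "(\<Sum>x\<in>U. eta i x * cosh x) = 1" using sum_eta_exp[OF assms] by simp
  have "(\<Sum>x\<in>U. eta i x * sinh x) = ((\<Sum>x\<in>U. eta i x * exp x) - (\<Sum>x\<in>U. eta i x * exp (- x))) / 2"
    by (simp add: sinh_field_def sum_divide_distrib sum_subtractf[symmetric] right_diff_distrib)
  then show "(\<Sum>x\<in>U. eta i x * sinh x) = 0" using sum_eta_exp[OF assms] by simp
qed

lemma mass_nonneg: "i < n \<Longrightarrow> 0 \<le> mass i"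
  unfolding mass_def using eta_nonneg by (intro sum_nonneg) auto

text \<open>With \<open>P = e\<^sup>x \<eta>\<close> and \<open>Q = e\<^sup>-\<^sup>x \<eta>\<close>, the tilted measure is \<open>(P + Q) / 2\<close>.\<close>
sublocale tilt: centered_family U "\<lambda>i x. eta i x * cosh x" tanh n
proof
  fix x :: real
  show "\<bar>tanh x\<bar> \<le> 1"
    using tanh_real_lt_1[of x] tanh_real_gt_neg1[of x] by (simp add: abs_le_iff)
next
  fix i assume i: "i < n"
  have "cosh x * tanh x = sinh x" for x :: real
    by (simp add: tanh_def cosh_real_pos[THEN less_imp_neq[THEN not_sym]])
  then show "(\<Sum>x\<in>U. eta i x * cosh x * tanh x) = 0"
    using sum_eta_cosh_sinh[OF i] by (simp add: mult.assoc)
qed (auto simp: eta_nonneg sum_eta_cosh_sinh)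

lemma T_conv_prod:
  "T (conv_prod eta n) = EE U eta n (\<lambda>xs. \<bar>exp (sum_list xs) - exp (- sum_list xs)\<bar>) / 2"
  by (simp add: T_def integ_conv_prod[OF finite_U supp])

text \<open>The tilting density times \<open>1 + tanh x\<close> or \<open>1 - tanh x\<close> is
  \<open>exp x\<close> or \<open>exp (- x)\<close>, so the weighted odd part is the hyperbolic sine
  of the sum.\<close>

lemma T_conv_prod_tilt:
  "T (conv_prod eta n) = EE U (\<lambda>i x. eta i x * cosh x) n (\<lambda>xs. \<bar>tilt.odd_part xs\<bar>)"
proof -
  have "prod_list (map cosh xs) * \<bar>tilt.odd_part xs\<bar>
      = (1/2) * \<bar>exp (sum_list xs) - exp (- sum_list xs)\<bar>" for xs :: "real list"
  proof -
    have c: "cosh x * (1 + 1 * tanh x) = exp x" "cosh x * (1 + - 1 * tanh x) = exp (- x)" for x :: real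
      by (simp_all add: tanh_def distrib_left right_diff_distrib cosh_real_pos[THEN less_imp_neq[THEN not_sym]]
          cosh_plus_sinh cosh_minus_sinh)
    have neg: "sum_list (map uminus xs) = - sum_list xs" by (induction xs) auto
    have "prod_list (map cosh xs) * tilt.odd_part xs
        = (prod_list (map cosh xs) * tilt.mul 1 xs - prod_list (map cosh xs) * tilt.mul (- 1) xs) / 2"
      by (simp add: tilt.odd_part_def right_diff_distrib)
    also have "\<dots> = (exp (sum_list xs) - exp (- sum_list xs)) / 2"
      unfolding prod_list_map_mult c using prod_list_map_exp[of "\<lambda>x. x" xs] prod_list_map_exp[of uminus xs]
      by (simp add: neg)
    finally have *: "prod_list (map cosh xs) * tilt.odd_part xs = (exp (sum_list xs) - exp (- sum_list xs)) / 2" .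
    have "0 \<le> prod_list (map cosh xs)" by (induction xs) auto
    then have "prod_list (map cosh xs) * \<bar>tilt.odd_part xs\<bar> = \<bar>prod_list (map cosh xs) * tilt.odd_part xs\<bar>"
      by (simp add: abs_mult)
    then show ?thesis unfolding * by simp
  qed
  then show ?thesis unfolding EE_weight T_conv_prod by (simp only: EE_cmult)
qed

text \<open>\<open>T\<close> is the total variation distance of two probability measures and
  \<open>m\<close> their Hellinger affinity; these are the classical inequalities between the
  two.\<close>

lemma T_conv_prod_bounds:
  defines "m \<equiv> \<Prod>i<n. mass i"
  shows "1 - m \<le> T (conv_prod eta n)" and "(T (conv_prod eta n))\<^sup>2 \<le> 1 - m\<^sup>2"
proof -
  let ?E = "EE U eta n"
  \<comment> \<open>Square roots of the two densities with respect to the product of the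
    \<open>eta i\<close>; their product is 1, which makes \<open>m\<close> the affinity.\<close>
  define a b where "a xs = exp (sum_list xs / 2)" and "b xs = exp (- sum_list xs / 2)" for xs :: "real list"
  have ab: "a xs * b xs = 1" "(a xs)\<^sup>2 = exp (sum_list xs)" "(b xs)\<^sup>2 = exp (- sum_list xs)" for xs
    by (simp_all add: a_def b_def power2_eq_square flip: exp_add)
  have pos: "0 < a xs" "0 < b xs" for xs by (simp_all add: a_def b_def)
  have neg: "sum_list (map uminus xs) = - sum_list xs" for xs :: "real list" by (induction xs) auto
  have E: "?E (\<lambda>xs. (a xs)\<^sup>2) = 1" "?E (\<lambda>xs. (b xs)\<^sup>2) = 1"
    using EE_prod[of U eta n exp] EE_prod[of U eta n "\<lambda>x. exp (- x)"]
      prod_list_map_exp[of "\<lambda>x. x"] prod_list_map_exp[of uminus]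
    by (simp_all add: ab sum_eta_exp neg)
  have m: "?E (\<lambda>_. c) = c * m" for c
    using EE_prod[of U eta n "\<lambda>_. 1"] EE_cmult[of U eta n c "\<lambda>_. 1"] by (simp add: m_def mass_def map_replicate_const)
  have sq: "(a xs + s * b xs)\<^sup>2 = (a xs)\<^sup>2 + s\<^sup>2 * (b xs)\<^sup>2 + 2 * s" for s xs
    using ab(1)[of xs] by algebra
  have Esq: "?E (\<lambda>xs. (a xs + b xs)\<^sup>2) = 2 + 2 * m" "?E (\<lambda>xs. (a xs - b xs)\<^sup>2) = 2 - 2 * m"
    using sq[of _ 1] sq[of _ "-1"] by (simp_all add: EE_add EE_diff E m)
  have abs: "\<bar>exp (sum_list xs) - exp (- sum_list xs)\<bar> = \<bar>a xs - b xs\<bar> * (a xs + b xs)" for xs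
    using pos[of xs] unfolding ab(2,3)[symmetric]
    by (simp add: square_diff_square_factored power2_eq_square abs_mult mult.commute)
  have nn: "\<And>i x. i < n \<Longrightarrow> x \<in> U \<Longrightarrow> 0 \<le> eta i x" by (rule eta_nonneg)
  have "2 - 2 * m \<le> ?E (\<lambda>xs. \<bar>a xs - b xs\<bar> * (a xs + b xs))"
    unfolding Esq(2)[symmetric]
  proof (rule EE_mono[OF nn])
    fix xs
    have "\<bar>a xs - b xs\<bar> * \<bar>a xs - b xs\<bar> \<le> \<bar>a xs - b xs\<bar> * (a xs + b xs)"
      using pos[of xs] by (intro mult_left_mono) auto
    then show "(a xs - b xs)\<^sup>2 \<le> \<bar>a xs - b xs\<bar> * (a xs + b xs)"
      by (simp add: power2_eq_square)
  qed
  then show "1 - m \<le> T (conv_prod eta n)" by (simp add: T_conv_prod abs)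
  have "(?E (\<lambda>xs. \<bar>a xs - b xs\<bar> * (a xs + b xs)))\<^sup>2 \<le> (2 - 2 * m) * (2 + 2 * m)"
    using EE_Cauchy_Schwarz[of n U eta "\<lambda>xs. \<bar>a xs - b xs\<bar>" "\<lambda>xs. a xs + b xs", OF nn] by (simp add: Esq)
  then show "(T (conv_prod eta n))\<^sup>2 \<le> 1 - m\<^sup>2"
    by (simp add: T_conv_prod abs power_divide) (simp add: power2_eq_square algebra_simps)
qed

text \<open>Pointwise, \<open>(sinh x)\<^sup>2 = (cosh x - 1) * (cosh x + 1)\<close> and
  \<open>cosh x + 1 \<le> 2 * cosh x\<close>; integrating uses that \<open>cosh\<close> has integral
  1.\<close>

lemma V_le: "tilt.V \<le> 2 * (\<Sum>i<n. 1 - mass i)"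
proof -
  have "tilt.v i \<le> 2 * (1 - mass i)" if i: "i < n" for i
  proof -
    have "cosh x * (tanh x)\<^sup>2 \<le> 2 * (cosh x - 1)" for x :: real
    proof -
      have c: "1 \<le> cosh x" by (rule cosh_real_ge_1)
      have "cosh x * (cosh x * (tanh x)\<^sup>2) = (sinh x)\<^sup>2"
        using c by (simp add: tanh_def power2_eq_square)
      also have "\<dots> = (cosh x - 1) * (cosh x + 1)"
        unfolding sinh_square_eq by (simp add: algebra_simps power2_eq_square)
      also have "\<dots> \<le> (cosh x - 1) * (2 * cosh x)" using c by (intro mult_left_mono) auto
      finally have "cosh x * (cosh x * (tanh x)\<^sup>2) \<le> cosh x * (2 * (cosh x - 1))" by (simp add: mult_ac)
      then show ?thesis using c by (simp only: mult_le_cancel_left_pos)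
    qed
    then have "tilt.v i \<le> (\<Sum>x\<in>U. eta i x * (2 * (cosh x - 1)))"
      unfolding tilt.v_def mult.assoc using eta_nonneg[OF i] by (intro sum_mono mult_left_mono) auto
    also have "\<dots> = 2 * ((\<Sum>x\<in>U. eta i x * cosh x) - mass i)"
      by (simp add: mass_def right_diff_distrib sum_subtractf sum_distrib_left mult_ac)
    finally show ?thesis using sum_eta_cosh_sinh[OF i] by simp
  qed
  then show ?thesis unfolding tilt.V_def sum_distrib_left by (intro sum_mono) auto
qed

section \<open>Comparison of the average with the given family\<close>

lemma admissible_family_avg:
  assumes n: "n \<ge> 1"
  shows "admissible_family U (\<lambda>_. avg n eta) n"
proof
  have supp_avg: "supp_m (avg n eta) \<subseteq> U"
  proof
    fix x assume "x \<in> supp_m (avg n eta)"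
    then have "(\<Sum>i<n. eta i x) \<noteq> 0" by (auto simp: supp_m_def avg_def)
    then obtain i where "i < n" "eta i x \<noteq> 0" by (auto dest: sum.not_neutral_contains_not_neutral)
    then show "x \<in> U" using supp[of i] by (auto simp: supp_m_def)
  qed
  then show "supp_m (avg n eta) \<subseteq> U" .
  show "admissible (avg n eta)"
    unfolding admissible_def fs_measure_def integ_superset[OF finite_U supp_avg] sum_avg
    using finite_subset[OF supp_avg finite_U] n by (auto intro!: avg_nonneg eta_nonneg simp: sum_eta_exp)
qed (rule finite_U)

lemma T_avg_le_small:
  assumes n: "n \<ge> 1" and e: "0 < e" "(\<Sum>i<n. 1 - mass i) \<le> e" and D: "Dfun e < 1"
  shows "T (conv_prod (\<lambda>_. avg n eta) n) \<le> (4 * sqrt 2 + Dfun e) / (1 - Dfun e) * T (conv_prod eta n)"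
proof -
  interpret A: admissible_family U "\<lambda>_. avg n eta" n
    by (rule admissible_family_avg[OF n])
  \<comment> \<open>Tilting commutes with averaging, so the tilted average is the average treated in
    \<open>tilt\<close>.\<close>
  have avg_tilt: "avg n eta x * cosh x = avg n (\<lambda>i x. eta i x * cosh x) x" for x
    by (simp add: avg_def sum_distrib_right)
  have "tilt.V \<le> 2 * e" using V_le e(2) by simp
  from tilt.EE_avg_odd_part_le[OF n e(1) this D] show ?thesis
    unfolding A.T_conv_prod_tilt T_conv_prod_tilt avg_tilt .
qed

text \<open>A large total defect forces \<open>m \<le> exp (- e)\<close>, and by AM-GM the average
  has at least the mass product \<open>m\<close>. The upper bound for the average and the lower
  bound for the family then differ by a bounded factor.\<close>

lemma T_avg_le_large:
  assumes n: "n \<ge> 1" and e: "0 < e" "e \<le> (\<Sum>i<n. 1 - mass i)"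
  shows "T (conv_prod (\<lambda>_. avg n eta) n) \<le> sqrt ((1 + exp (- e)) / (1 - exp (- e))) * T (conv_prod eta n)"
proof -
  interpret A: admissible_family U "\<lambda>_. avg n eta" n
    by (rule admissible_family_avg[OF n])
  define m where "m = (\<Prod>i<n. mass i)"
  define T1 where "T1 = T (conv_prod (\<lambda>_. avg n eta) n)"
  have m0: "0 \<le> m" unfolding m_def by (rule prod_nonneg) (simp add: mass_nonneg)
  have "m \<le> exp (- (\<Sum>i<n. 1 - mass i))"
    using prod_le_exp_sum[of n "\<lambda>i. 1 - mass i"] mass_nonneg by (simp add: m_def)
  then have me: "m \<le> exp (- e)" using e(2) by (meson exp_le_cancel_iff neg_le_iff_le order_trans)
  have e1: "exp (- e) < 1" using e(1) by simp
  have A_mass: "A.mass i = (\<Sum>i<n. mass i) / n" for i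
    unfolding A.mass_def mass_def using sum_avg[of n eta "\<lambda>_. 1" U] by simp
  have "m \<le> (\<Prod>i<n. A.mass i)"
    unfolding A_mass m_def using prod_le_arith_mean_power[OF n, of mass] mass_nonneg by simp
  then have "m\<^sup>2 \<le> (\<Prod>i<n. A.mass i)\<^sup>2" using m0 by (rule power_mono)
  then have "T1\<^sup>2 \<le> 1 - m\<^sup>2" using A.T_conv_prod_bounds(2) by (simp add: T1_def)
  \<comment> \<open>Isolates \<open>1 - m\<close>, the lower bound for \<open>T\<close>, from a
    factor that increases with \<open>m\<close>.\<close>
  also have "\<dots> = (1 + m) / (1 - m) * (1 - m)\<^sup>2"
  proof -
    have "1 - m \<noteq> 0" using order.strict_trans1[OF me e1] by simp
    then have "(1 + m) / (1 - m) * (1 - m)\<^sup>2 = (1 + m) * (1 - m)" by (simp add: power2_eq_square)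
    then show ?thesis by (simp add: power2_eq_square algebra_simps)
  qed
  also have "\<dots> \<le> (1 + exp (- e)) / (1 - exp (- e)) * (1 - m)\<^sup>2"
    using me e1 m0 by (intro mult_right_mono frac_le) auto
  finally have "T1 \<le> sqrt ((1 + exp (- e)) / (1 - exp (- e)) * (1 - m)\<^sup>2)"
    by (rule real_le_rsqrt)
  also have "\<dots> = sqrt ((1 + exp (- e)) / (1 - exp (- e))) * (1 - m)"
    using me e1 by (simp only: real_sqrt_mult real_sqrt_abs)
  also have "\<dots> \<le> sqrt ((1 + exp (- e)) / (1 - exp (- e))) * T (conv_prod eta n)"
    using T_conv_prod_bounds(1) e1 by (intro mult_left_mono) (auto simp: m_def)
  finally show ?thesis by (simp add: T1_def)
qed

lemma T_nonneg: "0 \<le> T (conv_prod eta n)"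
  unfolding T_conv_prod using eta_nonneg by (auto intro!: EE_nonneg)

lemma T_avg_le_C0:
  assumes n: "n \<ge> 1"
  shows "T (conv_prod (\<lambda>_. avg n eta) n) \<le> C0 * T (conv_prod eta n)"
proof -
  let ?T = "T (conv_prod eta n)" and ?T1 = "T (conv_prod (\<lambda>_. avg n eta) n)"
  have le: "?T1 \<le> Cfun e * ?T" if e: "0 < e" "Dfun e < 1" for e
  proof (cases "(\<Sum>i<n. 1 - mass i) \<le> e")
    case True
    show ?thesis
      by (rule order_trans[OF T_avg_le_small[OF n e(1) True e(2)] mult_right_mono])
        (simp_all add: Cfun_def T_nonneg)
  next
    case False
    then have large: "e \<le> (\<Sum>i<n. 1 - mass i)" by simp
    show ?thesis
      by (rule order_trans[OF T_avg_le_large[OF n e(1) large] mult_right_mono])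
        (simp_all add: Cfun_def T_nonneg)
  qed
  obtain e0 where e0: "0 < e0" "Dfun e0 < 1" using ex_Dfun_less_1 by auto
  \<comment> \<open>Passing to the infimum divides by \<open>?T\<close>; when \<open>?T = 0\<close>,
    the single value \<open>e0\<close> already suffices.\<close>
  show ?thesis
  proof (cases "?T = 0")
    case True
    then show ?thesis using le[OF e0] by simp
  next
    case False
    then have "0 < ?T" using T_nonneg by simp
    have "?T1 / ?T \<le> C0"
      unfolding C0_def
    proof (rule cInf_greatest)
      show "Cfun ` {e. 0 < e \<and> Dfun e < 1} \<noteq> {}" using e0 by auto
      fix c assume "c \<in> Cfun ` {e. 0 < e \<and> Dfun e < 1}"
      then show "?T1 / ?T \<le> c" using le \<open>0 < ?T\<close> by (auto simp: pos_divide_le_eq)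
    qed
    then show ?thesis using \<open>0 < ?T\<close> by (simp add: pos_divide_le_eq)
  qed
qed

end

theorem theorem5:
  fixes n :: nat and eta :: "nat \<Rightarrow> real \<Rightarrow> real"
  assumes "n \<ge> 1"
    and "\<And>i. i < n \<Longrightarrow> admissible (eta i)"
  shows "T (conv_pow (\<lambda>x. (1 / real n) * (\<Sum>i<n. eta i x)) n) \<le> C0 * T (conv_prod eta n)"
proof -
  interpret admissible_family "\<Union>i<n. supp_m (eta i)" eta n
    using assms(2) by unfold_locales (auto simp: admissible_def fs_measure_def)
  show ?thesis
    using T_avg_le_C0[OF assms(1)] by (simp add: conv_pow_eq_conv_prod avg_def[abs_def])
qed

end
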